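(* Let $F$ be a forest of size $n$. Then $$\sum_{w \in \mathcal{W}(F)} q^{\mathrm{maj}(F,w)} \prod_{v \in \mathrm{Cbtmax}(F,w)} t_v = \frac{n!}{\prod_{v \in V(F)} h_v} \prod_{v \in V(F)} \left([h_v]-1+t_v\right).$$
   Context: $F$ is a finite rooted plane forest with vertex set $V(F)=\{v_1,\dots,v_n\}$, $n\ge 1$. It is drawn with roots on top and regarded as the Hasse diagram of the poset $(V(F),<_F)$: $u<_F v$ means that $u\ne v$ and $u$ is a descendant of $v$. The vertices are naturally indexed: $v_i<_F v_j$ implies $i<j$. For a vertex $v$, $h_v=\#\{u: u\le_F v\}$ is the number of vertices of the subtree rooted at $v$. $\mathcal{W}(F)$ is the set of labelings of $F$, i.e. bijections $w:V(F)\to\{1,\dots,n\}$. The descent set is $\mathrm{Des}(F,w)=\{v\in V(F): v \text{ is not a root and } w(v)>w(u),\ u\text{ the parent of }v\}$, and $\mathrm{maj}(F,w)=\sum_{v\in \mathrm{Des}(F,w)}h_v$. Cyclic bottom-to-top maxima: let $p$ be the parent of $v$, with the convention $w(p)=n+1$ if $v$ is a root. If $w(v)<w(p)$, then $v$ is a cyclic bottom-to-top maximum if $\{u: u<_F v,\ w(u)\in[w(v),w(p)]\}=\emptyset$. If $w(p)<w(v)$, then $v$ is a cyclic bottom-to-top maximum if $\{u:u<_F v,\ w(u)\notin[w(p),w(v)]\}=\emptyset$. $\mathrm{Cbtmax}(F,w)$ is the set of all cyclic bottom-to-top maxima of $(F,w)$. $[m]=1+q+\cdots+q^{m-1}$;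 $q$ and $t_v$ ($v\in V(F)$) are commuting indeterminates. *)

theory Defs
  imports Complex_Main "HOL-Library.FuncSet" "HOL-Library.Poly_Mapping"
begin

text \<open>
  A finite rooted plane forest is the left-to-right list of its plane trees. A vertex is encoded
  by its address: \<open>[i]\<close> is the \<open>i\<close>-th root (counted from 0), and \<open>v @ [j]\<close> is the \<open>j\<close>-th child
  of \<open>v\<close>.
\<close>

datatype plane_tree = Node (subtrees: "plane_tree list")

type_synonym plane_forest = "plane_tree list"

type_synonym vertex = "nat list"

inductive is_vertex :: "plane_forest \<Rightarrow> vertex \<Rightarrow> bool" where
  root: "i < length F \<Longrightarrow> is_vertex F [i]"
| sub: "i < length F \<Longrightarrow> is_vertex (subtrees (F ! i)) v \<Longrightarrow> is_vertex F (i # v)"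

definition verts :: "plane_forest \<Rightarrow> vertex set" where
  "verts F = {v. is_vertex F v}"

definition is_root :: "vertex \<Rightarrow> bool" where
  "is_root v \<longleftrightarrow> length v = 1"

text \<open>Only meaningful for vertices that are not roots.\<close>

definition parent :: "vertex \<Rightarrow> vertex" where
  "parent v = butlast v"

definition child_rel :: "plane_forest \<Rightarrow> (vertex \<times> vertex) set" where
  "child_rel F = {(v, parent v) | v. v \<in> verts F \<and> \<not> is_root v}"

text \<open>The forest order: roots are maximal, \<open>below F u v\<close> means that \<open>u\<close> is a proper descendant
  of \<open>v\<close>.\<close>

definition below :: "plane_forest \<Rightarrow> vertex \<Rightarrow> vertex \<Rightarrow> bool" where
  "below F u v \<longleftrightarrow> (u, v) \<in> (child_rel F)\<^sup>+"

definition hook :: "plane_forest \<Rightarrow> vertex \<Rightarrow> nat" where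
  "hook F v = card {u \<in> verts F. u = v \<or> below F u v}"

text \<open>Labelings are extensional functions, so that a labeling is determined by its values on the
  vertices.\<close>

definition labelings :: "plane_forest \<Rightarrow> (vertex \<Rightarrow> nat) set" where
  "labelings F =
     {w \<in> verts F \<rightarrow>\<^sub>E {1..card (verts F)}. bij_betw w (verts F) {1..card (verts F)}}"

definition Des :: "plane_forest \<Rightarrow> (vertex \<Rightarrow> nat) \<Rightarrow> vertex set" where
  "Des F w = {v \<in> verts F. \<not> is_root v \<and> w v > w (parent v)}"

definition maj :: "plane_forest \<Rightarrow> (vertex \<Rightarrow> nat) \<Rightarrow> nat" where
  "maj F w = (\<Sum>v\<in>Des F w. hook F v)"

definition parent_label :: "plane_forest \<Rightarrow> (vertex \<Rightarrow> nat) \<Rightarrow> vertex \<Rightarrow> nat" where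
  "parent_label F w v = (if is_root v then card (verts F) + 1 else w (parent v))"

definition Cbtmax :: "plane_forest \<Rightarrow> (vertex \<Rightarrow> nat) \<Rightarrow> vertex set" where
  "Cbtmax F w = {v \<in> verts F.
     (w v < parent_label F w v \<and> {u. below F u v \<and> w u \<in> {w v..parent_label F w v}} = {}) \<or>
     (parent_label F w v < w v \<and> {u. below F u v \<and> w u \<notin> {parent_label F w v..w v}} = {})}"

text \<open>
  Polynomials with rational coefficients in the commuting indeterminates \<open>q\<close> and \<open>t\<^sub>v\<close>: finitely
  supported maps from monomials (finitely supported exponent vectors) to coefficients, whose
  product is convolution.
\<close>

datatype indet = Q_ind | T_ind vertex

type_synonym qt_poly = "(indet \<Rightarrow>\<^sub>0 nat) \<Rightarrow>\<^sub>0 rat"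

definition Var :: "indet \<Rightarrow> qt_poly" where
  "Var x = Poly_Mapping.single (Poly_Mapping.single x 1) 1"

definition Const :: "rat \<Rightarrow> qt_poly" where
  "Const c = Poly_Mapping.single 0 c"

definition qX :: qt_poly where
  "qX = Var Q_ind"

definition tX :: "vertex \<Rightarrow> qt_poly" where
  "tX v = Var (T_ind v)"

definition q_bracket :: "nat \<Rightarrow> qt_poly" where
  "q_bracket m = (\<Sum>i<m. qX ^ i)"

text \<open>The cardinalities above are those of finite sets.\<close>

lemma is_vertex_iff:
  "is_vertex F v \<longleftrightarrow>
     (\<exists>i<length F. v = [i] \<or> (\<exists>u. v = i # u \<and> is_vertex (subtrees (F ! i)) u))"
  by (subst is_vertex.simps) auto

lemma finite_verts_subtrees: "finite (verts (subtrees T))"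
proof (induction T)
  case (Node F)
  have "verts F \<subseteq>
      (\<lambda>i. [i]) ` {..<length F} \<union> (\<Union>i<length F. (#) i ` verts (subtrees (F ! i)))"
    by (auto simp: verts_def is_vertex_iff[of F])
  moreover have "finite \<dots>"
    using Node by auto
  ultimately have "finite (verts F)"
    by (rule finite_subset)
  then show ?case
    by simp
qed

lemma finite_verts: "finite (verts F)"
  using finite_verts_subtrees[of "Node F"] by simp

end

theory Submission
  imports Defs "HOL-Library.Sublist" "HOL-Combinatorics.Permutations"
begin

text \<open>
  Attach to a labeled vertex \<open>v\<close> its cyclic gap \<open>gap F v w\<close>: the number of descendants of \<open>v\<close> whose
  label is met when one walks upwards from \<open>w v\<close> to the label of the parent of \<open>v\<close>, jumping from
  the largest label to the smallest if necessary. It lies in \<open>{0..<hook F v}\<close>, and the theorem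
  says that the gaps of the vertices of a uniformly random labeling are independent and uniform.
  Three facts make this precise.

  Both statistics are functions of the gaps. By definition \<open>v\<close> is a cyclic bottom-to-top maximum iff
  its gap is \<open>0\<close> (\<open>Cbtmax_iff_gap\<close>), and \<open>maj F w\<close> is the sum of all gaps (\<open>maj_eq_sum_gap\<close>). For
  the latter, the gap of \<open>v\<close> is the number of labels in its subtree that exceed \<open>w v\<close>, minus the
  number of those that exceed the label of the parent, plus \<open>hook F v\<close> if \<open>v\<close> is a descent; in the
  sum over \<open>v\<close> the first two terms cancel.

  The labels of the subtree of a vertex \<open>v\<close> can be rotated: each is replaced by the next one, and the
  largest by the smallest. This permutes the labelings. It lowers the gap of \<open>v\<close> by one modulo
  \<open>hook F v\<close> (\<open>gap_rotate_same\<close>) and leaves every other gap alone (\<open>gap_rotate_other\<close>): below \<open>v\<close>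
  only the cyclic order of the labels of the subtree matters, and elsewhere only the set of these
  labels.

  Hence one may average over the rotations at one vertex after the other (\<open>independent_uniform\<close>), so
  the sum over the labelings, multiplied by the product of all hook lengths, is \<open>n!\<close> times the
  product over \<open>v\<close> of the sums of \<open>q\<^sup>j\<close> over \<open>j < hook F v\<close>, where the term \<open>j = 0\<close> carries the
  factor \<open>t\<^sub>v\<close>.
\<close>

section \<open>Cyclic order\<close>

text \<open>
  Walking upwards from \<open>a\<close>, with the jump from the top to the bottom, one meets \<open>x\<close> strictly before
  \<open>b\<close>. The three disjuncts are the three linear arrangements of the cyclic order \<open>a, x, b\<close>.
\<close>

definition cyc_between :: "nat \<Rightarrow> nat \<Rightarrow> nat \<Rightarrow> bool" where
  "cyc_between a x b \<longleftrightarrow> a < x \<and> x < b \<or> b < a \<and> a < x \<or> x < b \<and> b < a"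

definition cyc_gap :: "nat set \<Rightarrow> nat \<Rightarrow> nat \<Rightarrow> nat" where
  "cyc_gap S a b = card {x \<in> S. cyc_between a x b}"

definition cyc_next :: "nat set \<Rightarrow> nat \<Rightarrow> nat" where
  "cyc_next S a = (if a = Max S then Min S else Min {x \<in> S. a < x})"

lemma cyc_next_in:
  assumes "finite S" "a \<in> S"
  shows "cyc_next S a \<in> S"
proof (cases "a = Max S")
  case True
  then show ?thesis using assms by (auto simp: cyc_next_def intro: Min_in)
next
  case False
  then have "a < Max S" using assms by (simp add: order_less_le)
  then have "{x \<in> S. a < x} \<noteq> {}" using assms by (auto intro: Max_in)
  from Min_in[OF _ this] show ?thesis using assms False by (auto simp: cyc_next_def)
qed

lemma cyc_next_greater:
  assumes "finite S" "a \<in> S" "a \<noteq> Max S"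
  shows "a < cyc_next S a"
proof -
  have "a < Max S" using assms by (simp add: order_less_le)
  then have "{x \<in> S. a < x} \<noteq> {}" using assms by (auto intro: Max_in)
  from Min_in[OF _ this] show ?thesis using assms by (auto simp: cyc_next_def)
qed

lemma cyc_next_le:
  assumes "finite S" "x \<in> S" "a < x"
  shows "cyc_next S a \<le> x"
proof -
  have "a \<noteq> Max S" using assms(3) Max_ge[OF assms(1,2)] by linarith
  then show ?thesis using assms by (auto simp: cyc_next_def)
qed

text \<open>
  Together with the next lemma, this describes \<open>cyc_next S\<close> as an order: it keeps the order of the
  elements other than the maximum and moves the maximum below all of them.
\<close>

lemma cyc_next_mono:
  assumes "finite S" "a \<in> S" "b \<in> S" "a < b" "b \<noteq> Max S"
  shows "cyc_next S a < cyc_next S b"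
  using cyc_next_le[of S b a] cyc_next_greater[of S b] assms by auto

lemma cyc_next_Max_less:
  assumes "finite S" "b \<in> S" "b \<noteq> Max S"
  shows "cyc_next S (Max S) < cyc_next S b"
  using cyc_next_greater[OF assms] Min_le[OF assms(1,2)] by (simp add: cyc_next_def)

lemma cyc_next_bij:
  assumes "finite S"
  shows "bij_betw (cyc_next S) S S"
proof -
  have "inj_on (cyc_next S) S"
  proof (rule linorder_inj_onI)
    fix a b assume "a < b" "a \<in> S" "b \<in> S"
    then show "cyc_next S a \<noteq> cyc_next S b"
      using cyc_next_mono[OF assms, of a b] cyc_next_Max_less[OF assms, of a]
      by (cases "b = Max S") auto
  qed auto
  moreover have "cyc_next S ` S \<subseteq> S" using cyc_next_in assms by auto
  ultimately show ?thesis using endo_inj_surj[OF assms] by (auto simp: bij_betw_def)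
qed

text \<open>
  Taking the last element of a linear order and putting it in front does not change the induced cyclic
  order.
\<close>

lemma cyc_between_cyc_next:
  assumes "finite S" "a \<in> S" "x \<in> S" "b \<in> S"
  shows "cyc_between (cyc_next S a) (cyc_next S x) (cyc_next S b) \<longleftrightarrow> cyc_between a x b"
proof -
  define M where "M = Max S"
  let ?f = "cyc_next S"
  have le: "y \<le> M" if "y \<in> S" for y using assms(1) that by (simp add: M_def)
  have lt: "?f y < ?f z \<longleftrightarrow> (if z = M then False else y = M \<or> y < z)" if "y \<in> S" "z \<in> S" for y z
  proof (cases "z = M")
    case True
    then show ?thesis using cyc_next_Max_less[OF assms(1) that(1)] by (cases "y = M") (auto simp: M_def)
  next
    case False
    then show ?thesis
      using cyc_next_mono[OF assms(1) that] cyc_next_mono[OF assms(1) that(2,1)]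
        cyc_next_Max_less[OF assms(1) that(2)] le[OF that(1)] le[OF that(2)]
      unfolding M_def[symmetric] by (cases "y = M"; cases y z rule: linorder_cases) auto
  qed
  show ?thesis
    using le[OF assms(2)] le[OF assms(3)] le[OF assms(4)]
    by (auto simp: cyc_between_def lt assms split: if_splits)
qed

lemma cyc_gap_cyc_next:
  assumes "finite S" "T \<subseteq> S" "a \<in> S" "b \<in> S"
  shows "cyc_gap (cyc_next S ` T) (cyc_next S a) (cyc_next S b) = cyc_gap T a b"
proof -
  have "{x \<in> cyc_next S ` T. cyc_between (cyc_next S a) x (cyc_next S b)} =
        cyc_next S ` {x \<in> T. cyc_between a x b}"
    using assms cyc_between_cyc_next[OF assms(1) assms(3) _ assms(4)] by blast
  moreover have "inj_on (cyc_next S) {x \<in> T. cyc_between a x b}"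
    using cyc_next_bij[OF assms(1)] assms(2) by (auto simp: bij_betw_def intro: inj_on_subset)
  ultimately show ?thesis by (simp add: cyc_gap_def card_image)
qed

text \<open>
  No element of \<open>S\<close> lies strictly between \<open>a\<close> and its successor. If \<open>b\<close> is not between them either,
  moving the starting point from \<open>a\<close> to its successor just loses the successor itself. If \<open>b\<close> is
  between them, the gap of \<open>a\<close> is empty and the gap of the successor is as large as possible, which
  is where the count wraps around.
\<close>

lemma cyc_gap_step:
  assumes fin: "finite S" and a: "a \<in> S" and b: "b \<notin> S"
  shows "cyc_gap S a b = Suc (cyc_gap S (cyc_next S a) b) mod card S"
proof (cases "S = {a}")
  case True
  then show ?thesis by (auto simp: cyc_gap_def cyc_between_def cyc_next_def)
next
  case False
  define a' where "a' = cyc_next S a"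
  have a': "a' \<in> S" using cyc_next_in[OF fin a] by (simp add: a'_def)
  have le: "x \<le> Max S" "Min S \<le> x" if "x \<in> S" for x using fin that by auto
  have ne: "a \<noteq> a'"
  proof (cases "a = Max S")
    case True
    with False fin a have "\<exists>x\<in>S. x \<noteq> a" by auto
    then have "Min S < Max S" using le True by (metis nat_less_le le_trans antisym)
    then show ?thesis using True by (simp add: a'_def cyc_next_def)
  qed (use cyc_next_greater[OF fin a] in \<open>auto simp: a'_def\<close>)
  \<comment> \<open>\<open>a'\<close> is the immediate successor of \<open>a\<close> in \<open>S\<close>.\<close>
  have nb: "\<not> cyc_between a x a'" if "x \<in> S" for x
  proof (cases "a = Max S")
    case True
    then show ?thesis using le[OF that] by (auto simp: a'_def cyc_next_def cyc_between_def)
  next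
    case False
    then show ?thesis using cyc_next_greater[OF fin a] cyc_next_le[OF fin that, of a]
      by (auto simp: a'_def cyc_between_def)
  qed
  have bx: "b \<noteq> x" if "x \<in> S" for x using that b by auto
  show ?thesis
  proof (cases "cyc_between a b a'")
    case True
    have "{x \<in> S. cyc_between a x b} = {}"
      using nb True by (fastforce simp: cyc_between_def)
    moreover have "cyc_between a' x b \<longleftrightarrow> x \<noteq> a'" if "x \<in> S" for x
      using nb[OF that] True ne bx[OF that] unfolding cyc_between_def by linarith
    then have "{x \<in> S. cyc_between a' x b} = S - {a'}" by auto
    moreover have "card S > 0" using fin a by (auto simp: card_gt_0_iff)
    ultimately show ?thesis using a' fin by (simp add: cyc_gap_def flip: a'_def)
  next
    case False
    have "cyc_between a x b \<longleftrightarrow> x = a' \<or> cyc_between a' x b" if "x \<in> S" for x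
      using nb[OF that] False ne bx[OF a'] bx[OF a] unfolding cyc_between_def by linarith
    then have eq: "{x \<in> S. cyc_between a x b} = insert a' {x \<in> S. cyc_between a' x b}"
      using a' by auto
    have "a' \<notin> {x \<in> S. cyc_between a' x b}" by (auto simp: cyc_between_def)
    then have "cyc_gap S a b = Suc (cyc_gap S a' b)"
      using fin by (simp add: cyc_gap_def eq)
    moreover have "cyc_gap S a b < card S"
      unfolding cyc_gap_def using a fin by (intro psubset_card_mono) (auto simp: cyc_between_def)
    ultimately show ?thesis by (simp flip: a'_def)
  qed
qed

section \<open>Averaging over a cyclic shift\<close>

text \<open>
  The bijection \<open>\<rho>\<close> maps the level set of \<open>c\<close> at \<open>j + 1\<close> onto the level set at \<open>j\<close> and preserves
  \<open>X\<close>, so all \<open>h\<close> level sets carry the same total weight. Thus \<open>c\<close> is uniform on \<open>{..<h}\<close> and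
  independent of \<open>X\<close>.
\<close>

lemma average_cyclic_shift:
  fixes f :: "nat \<Rightarrow> 'b::comm_semiring_1" and X :: "'a \<Rightarrow> 'b"
  assumes fin: "finite \<Omega>" and h: "h > 0" and bij: "bij_betw \<rho> \<Omega> \<Omega>"
    and c: "\<And>w. w \<in> \<Omega> \<Longrightarrow> c w = Suc (c (\<rho> w)) mod h"
    and X: "\<And>w. w \<in> \<Omega> \<Longrightarrow> X (\<rho> w) = X w"
  shows "of_nat h * (\<Sum>w\<in>\<Omega>. f (c w) * X w) = (\<Sum>j<h. f j) * (\<Sum>w\<in>\<Omega>. X w)"
proof -
  define T where "T j = (\<Sum>w\<in>{w \<in> \<Omega>. c w = j}. X w)" for j
  have ch: "c w < h" if "w \<in> \<Omega>" for w using c[OF that] h by simp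
  have split: "(\<Sum>w\<in>\<Omega>. g (c w) * X w) = (\<Sum>j<h. g j * T j)" for g :: "nat \<Rightarrow> 'b"
  proof -
    have "(\<Sum>w\<in>\<Omega>. g (c w) * X w) = (\<Sum>j<h. \<Sum>w\<in>{w \<in> \<Omega>. c w = j}. g (c w) * X w)"
      by (rule sum.group[symmetric]) (use fin ch in auto)
    then show ?thesis by (simp add: T_def sum_distrib_left)
  qed
  have shift: "T (Suc j) = T j" if "Suc j < h" for j
  proof -
    have "bij_betw \<rho> {w \<in> \<Omega>. c w = Suc j} {w \<in> \<Omega>. c w = j}"
      unfolding bij_betw_def
    proof
      show "inj_on \<rho> {w \<in> \<Omega>. c w = Suc j}"
        using bij by (auto simp: bij_betw_def intro: inj_on_subset)
      have iff: "c w = Suc j \<longleftrightarrow> c (\<rho> w) = j" if "w \<in> \<Omega>" for w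
      proof -
        have "\<rho> w \<in> \<Omega>" using bij that by (auto simp: bij_betw_def)
        then have "c (\<rho> w) < h" by (rule ch)
        then show ?thesis using c[OF that] \<open>Suc j < h\<close>
          by (cases "Suc (c (\<rho> w)) = h") auto
      qed
      show "\<rho> ` {w \<in> \<Omega>. c w = Suc j} = {w \<in> \<Omega>. c w = j}"
      proof safe
        fix w assume "w \<in> \<Omega>" "c w = Suc j"
        then show "\<rho> w \<in> \<Omega>" "c (\<rho> w) = j" using bij iff by (auto simp: bij_betw_def)
      next
        fix w assume w: "w \<in> \<Omega>" "j = c w"
        then obtain w' where "w' \<in> \<Omega>" "w = \<rho> w'" using bij by (auto simp: bij_betw_def)
        then show "w \<in> \<rho> ` {u \<in> \<Omega>. c u = Suc (c w)}" using iff w by auto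
      qed
    qed
    from sum.reindex_bij_betw[OF this, of X] show ?thesis
      by (simp add: T_def X)
  qed
  have T0: "T j = T 0" if "j < h" for j
    using that by (induction j) (auto simp: shift)
  have const: "(\<Sum>w\<in>\<Omega>. g (c w) * X w) = (\<Sum>j<h. g j) * T 0" for g :: "nat \<Rightarrow> 'b"
    unfolding split sum_distrib_right
  proof (rule sum.cong[OF refl])
    fix j assume "j \<in> {..<h}"
    then have "T j = T 0" by (intro T0) simp
    then show "g j * T j = g j * T 0" by (rule arg_cong)
  qed
  have "(\<Sum>w\<in>\<Omega>. X w) = of_nat h * T 0"
    using const[of "\<lambda>_. 1"] by simp
  then show ?thesis using const[of f] by (simp add: mult.left_commute)
qed

text \<open>
  If each statistic \<open>c v\<close> has its own bijection that shifts it cyclically without disturbing the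
  others, then the statistics are independent and uniform: the preceding lemma splits off the factor
  of one index, with the product of the remaining factors as invariant weight.
\<close>

lemma independent_uniform:
  fixes f :: "'v \<Rightarrow> nat \<Rightarrow> 'b::comm_semiring_1"
  assumes fin: "finite \<Omega>" and A: "finite A"
    and h: "\<And>v. v \<in> A \<Longrightarrow> h v > 0"
    and bij: "\<And>v. v \<in> A \<Longrightarrow> bij_betw (\<rho> v) \<Omega> \<Omega>"
    and own: "\<And>v w. v \<in> A \<Longrightarrow> w \<in> \<Omega> \<Longrightarrow> c v w = Suc (c v (\<rho> v w)) mod h v"
    and other: "\<And>u v w. u \<in> A \<Longrightarrow> v \<in> A \<Longrightarrow> u \<noteq> v \<Longrightarrow> w \<in> \<Omega> \<Longrightarrow> c u (\<rho> v w) = c u w"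
  shows "of_nat (\<Prod>v\<in>A. h v) * (\<Sum>w\<in>\<Omega>. \<Prod>v\<in>A. f v (c v w)) =
    of_nat (card \<Omega>) * (\<Prod>v\<in>A. \<Sum>j<h v. f v j)"
  using A h bij own other
proof (induction A rule: finite_induct)
  case empty
  then show ?case by simp
next
  case (insert v A)
  let ?m = "of_nat (\<Prod>u\<in>A. h u) :: 'b" and ?s = "\<Sum>j<h v. f v j"
  have step: "of_nat (h v) * (\<Sum>w\<in>\<Omega>. f v (c v w) * (\<Prod>u\<in>A. f u (c u w))) =
    ?s * (\<Sum>w\<in>\<Omega>. \<Prod>u\<in>A. f u (c u w))"
  proof (rule average_cyclic_shift[OF fin])
    show "h v > 0" "bij_betw (\<rho> v) \<Omega> \<Omega>" using insert.prems(1,2) by simp_all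
    show "c v w = Suc (c v (\<rho> v w)) mod h v" if "w \<in> \<Omega>" for w
      using that by (intro insert.prems(3)) simp_all
    show "(\<Prod>u\<in>A. f u (c u (\<rho> v w))) = (\<Prod>u\<in>A. f u (c u w))" if "w \<in> \<Omega>" for w
    proof (rule prod.cong[OF refl])
      fix u assume "u \<in> A"
      then show "f u (c u (\<rho> v w)) = f u (c u w)"
        using insert.prems(4)[of u v w] insert.hyps that by fastforce
    qed
  qed
  have IH: "?m * (\<Sum>w\<in>\<Omega>. \<Prod>u\<in>A. f u (c u w)) =
    of_nat (card \<Omega>) * (\<Prod>u\<in>A. \<Sum>j<h u. f u j)"
    by (intro insert.IH; rule insert.prems) simp_all
  have "of_nat (\<Prod>u\<in>insert v A. h u) * (\<Sum>w\<in>\<Omega>. \<Prod>u\<in>insert v A. f u (c u w)) =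
    ?m * (of_nat (h v) * (\<Sum>w\<in>\<Omega>. f v (c v w) * (\<Prod>u\<in>A. f u (c u w))))"
    using insert.hyps by (simp add: mult_ac)
  also have "\<dots> = ?s * (?m * (\<Sum>w\<in>\<Omega>. \<Prod>u\<in>A. f u (c u w)))"
    unfolding step by (rule mult.left_commute)
  also have "\<dots> = of_nat (card \<Omega>) * (\<Prod>u\<in>insert v A. \<Sum>j<h u. f u j)"
    unfolding IH using insert.hyps by (simp add: mult.left_commute)
  finally show ?case .
qed

section \<open>Addresses and subtrees\<close>

lemma vertex_not_Nil: "v \<in> verts F \<Longrightarrow> v \<noteq> []"
  by (auto simp: verts_def elim: is_vertex.cases)

lemma is_vertex_prefix: "is_vertex F u \<Longrightarrow> prefix v u \<Longrightarrow> v \<noteq> [] \<Longrightarrow> is_vertex F v"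
proof (induction arbitrary: v rule: is_vertex.induct)
  case (root i F)
  then show ?case by (auto simp: prefix_Cons intro: is_vertex.root)
next
  case (sub i F u)
  then obtain v' where "v = i # v'" "prefix v' u" by (auto simp: prefix_Cons)
  then show ?case using sub by (cases "v' = []") (auto intro: is_vertex.intros)
qed

lemma verts_prefix: "u \<in> verts F \<Longrightarrow> prefix v u \<Longrightarrow> v \<noteq> [] \<Longrightarrow> v \<in> verts F"
  using is_vertex_prefix by (auto simp: verts_def)

lemma is_root_iff_butlast: "v \<in> verts F \<Longrightarrow> is_root v \<longleftrightarrow> butlast v = []"
  using vertex_not_Nil[of v F] by (cases v rule: rev_cases) (auto simp: is_root_def)

lemma parent_in_verts: "v \<in> verts F \<Longrightarrow> \<not> is_root v \<Longrightarrow> parent v \<in> verts F"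
  by (auto simp: parent_def is_root_iff_butlast prefixeq_butlast intro: verts_prefix)

lemma strict_prefix_parent: "v \<in> verts F \<Longrightarrow> strict_prefix (parent v) v"
  using vertex_not_Nil[of v F] by (cases v rule: rev_cases) (auto simp: parent_def strict_prefix_def)

lemma prefix_parent_iff: "u \<in> verts F \<Longrightarrow> prefix v (parent u) \<longleftrightarrow> strict_prefix v u"
  using vertex_not_Nil[of u F] by (cases u rule: rev_cases) (auto simp: parent_def strict_prefix_def)

text \<open>
  This turns the forest order into the strict prefix order of addresses, so that two vertices with a
  common descendant are comparable because two prefixes of one list are.
\<close>

lemma below_iff: "below F u v \<longleftrightarrow> u \<in> verts F \<and> v \<noteq> [] \<and> strict_prefix v u"
proof
  assume "below F u v"
  then have "(u, v) \<in> (child_rel F)\<^sup>+" by (simp add: below_def)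
  then show "u \<in> verts F \<and> v \<noteq> [] \<and> strict_prefix v u"
  proof (induction rule: trancl_induct)
    case (base y)
    then show ?case
      using parent_in_verts[of u F] vertex_not_Nil[of "parent u" F] strict_prefix_parent[of u F]
      by (auto simp: child_rel_def)
  next
    case (step y z)
    then show ?case
      using parent_in_verts[of y F] vertex_not_Nil[of "parent y" F] strict_prefix_parent[of y F]
      by (auto simp: child_rel_def intro: prefix_order.less_trans)
  qed
next
  show "u \<in> verts F \<and> v \<noteq> [] \<and> strict_prefix v u \<Longrightarrow> below F u v"
  proof (induction u rule: length_induct)
    case (1 u)
    then have u: "u \<in> verts F" "v \<noteq> []" "prefix v (parent u)"
      by (auto simp: prefix_parent_iff)
    then have "parent u \<noteq> []" by auto
    then have nr: "\<not> is_root u" using u by (auto simp: is_root_iff_butlast parent_def)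
    then have edge: "(u, parent u) \<in> child_rel F" using u by (auto simp: child_rel_def)
    show ?case
    proof (cases "v = parent u")
      case True
      then show ?thesis using edge by (auto simp: below_def)
    next
      case False
      then have "strict_prefix v (parent u)" using u by (simp add: strict_prefix_def)
      moreover have "length (parent u) < length u"
        using strict_prefix_parent[OF u(1)] by (rule prefix_length_less)
      ultimately have "below F (parent u) v"
        using 1 u parent_in_verts[OF u(1) nr] by blast
      then show ?thesis using edge by (auto simp: below_def intro: trancl_into_trancl2)
    qed
  qed
qed

definition subtree :: "plane_forest \<Rightarrow> vertex \<Rightarrow> vertex set" where
  "subtree F v = {u \<in> verts F. prefix v u}"

lemma finite_subtree: "finite (subtree F v)"
  using finite_verts by (simp add: subtree_def)

lemma subtree_subset: "subtree F v \<subseteq> verts F"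
  by (auto simp: subtree_def)

lemma hook_eq_card_subtree: "v \<in> verts F \<Longrightarrow> hook F v = card (subtree F v)"
  unfolding hook_def subtree_def below_iff
  by (rule arg_cong[where f = card]) (auto simp: strict_prefix_def dest: vertex_not_Nil)

lemma self_in_subtree: "v \<in> verts F \<Longrightarrow> v \<in> subtree F v"
  by (simp add: subtree_def)

lemma hook_pos: "v \<in> verts F \<Longrightarrow> hook F v > 0"
  using self_in_subtree[of v F] finite_subtree[of F v]
  by (auto simp: hook_eq_card_subtree card_gt_0_iff)

section \<open>Cyclic gaps of a labeling\<close>

text \<open>
  In this form the gap of \<open>v\<close> depends only on the set of labels in the subtree of \<open>v\<close>, on the label
  of \<open>v\<close> and on the label of its parent. The label of \<open>v\<close> is in the set, but it is never counted.
\<close>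

definition gap :: "plane_forest \<Rightarrow> vertex \<Rightarrow> (vertex \<Rightarrow> nat) \<Rightarrow> nat" where
  "gap F v w = cyc_gap (w ` subtree F v) (w v) (parent_label F w v)"

lemma labelingsD:
  assumes "w \<in> labelings F"
  shows "inj_on w (verts F)" "w ` verts F = {1..card (verts F)}" "w \<in> extensional (verts F)"
  using assms by (auto simp: labelings_def bij_betw_def PiE_def)

lemma labelingsI:
  assumes "inj_on w (verts F)" "w ` verts F = {1..card (verts F)}" "w \<in> extensional (verts F)"
  shows "w \<in> labelings F"
  using assms by (auto simp: labelings_def bij_betw_def PiE_def)

lemma finite_labelings: "finite (labelings F)"
  by (rule finite_subset[of _ "verts F \<rightarrow>\<^sub>E {1..card (verts F)}"])
    (auto simp: labelings_def finite_verts intro: finite_PiE)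

text \<open>
  Composition with a fixed bijection \<open>b\<close> between the vertices and \<open>{1..n}\<close> identifies the labelings
  with the permutations of \<open>{1..n}\<close>.
\<close>

lemma card_labelings: "card (labelings F) = fact (card (verts F))"
proof -
  define n where "n = card (verts F)"
  have "\<exists>b. bij_betw b (verts F) {1..n}"
    by (rule finite_same_card_bij) (simp_all add: finite_verts n_def)
  then obtain b where b: "bij_betw b (verts F) {1..n}" ..
  have "bij_betw (\<lambda>p. restrict (p \<circ> b) (verts F)) {p. p permutes {1..n}} (labelings F)"
  proof (rule bij_betwI')
    fix p p' assume p: "p \<in> {p. p permutes {1..n}}" "p' \<in> {p. p permutes {1..n}}"
    show "restrict (p \<circ> b) (verts F) = restrict (p' \<circ> b) (verts F) \<longleftrightarrow> p = p'"
    proof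
      assume eq: "restrict (p \<circ> b) (verts F) = restrict (p' \<circ> b) (verts F)"
      show "p = p'"
      proof
        fix x
        show "p x = p' x"
        proof (cases "x \<in> {1..n}")
          case True
          then have "x \<in> b ` verts F" using bij_betw_imp_surj_on[OF b] by blast
          then obtain v where "v \<in> verts F" "x = b v" by blast
          then show ?thesis using fun_cong[OF eq, of v] by simp
        qed (use p in \<open>auto simp: permutes_def\<close>)
      qed
    qed simp
  next
    fix p assume "p \<in> {p. p permutes {1..n}}"
    then have "bij_betw (p \<circ> b) (verts F) {1..n}"
      using b by (auto intro: bij_betw_trans permutes_imp_bij)
    then have "bij_betw (restrict (p \<circ> b) (verts F)) (verts F) {1..n}"
      by (simp cong: bij_betw_cong)
    then show "restrict (p \<circ> b) (verts F) \<in> labelings F"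
      unfolding bij_betw_def n_def by (intro labelingsI) auto
  next
    fix w assume "w \<in> labelings F"
    note w = labelingsD[OF this]
    define b' where "b' = inv_into (verts F) b"
    define p where "p = (\<lambda>x. if x \<in> {1..n} then w (b' x) else x)"
    have "bij_betw b' {1..n} (verts F)" using b by (simp add: b'_def bij_betw_inv_into)
    moreover have "bij_betw w (verts F) {1..n}" using w by (simp add: bij_betw_def n_def)
    ultimately have "bij_betw (w \<circ> b') {1..n} {1..n}" by (rule bij_betw_trans)
    then have "bij_betw p {1..n} {1..n}"
      by (rule iffD1[OF bij_betw_cong, rotated]) (simp add: p_def)
    then have "p permutes {1..n}" by (rule bij_imp_permutes) (auto simp: p_def)
    moreover have "w = restrict (p \<circ> b) (verts F)"
    proof
      fix v
      show "w v = restrict (p \<circ> b) (verts F) v"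
      proof (cases "v \<in> verts F")
        case True
        then have "b v \<in> {1..n}" "b' (b v) = v" 
          using bij_betwE[OF b] bij_betw_inv_into_left[OF b] by (auto simp: b'_def)
        then show ?thesis using True by (simp add: p_def)
      qed (use w in \<open>simp add: extensional_def\<close>)
    qed
    ultimately show "\<exists>p\<in>{p. p permutes {1..n}}. w = restrict (p \<circ> b) (verts F)" by blast
  qed
  from bij_betw_same_card[OF this] card_permutations[of "{1..n}" n]
  show ?thesis by (simp add: n_def)
qed

text \<open>
  The label of the parent (\<open>n + 1\<close> for a root) is not in the subtree. So a gap
  is always measured towards a label outside the subtree, as \<open>cyc_gap_step\<close> requires.
\<close>

lemma parent_label_fresh:
  assumes w: "w \<in> labelings F" and v: "v \<in> verts F"
  shows "parent_label F w v \<notin> w ` subtree F v"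
proof (cases "is_root v")
  case True
  have "w ` subtree F v \<subseteq> {1..card (verts F)}"
    using image_mono[OF subtree_subset] labelingsD(2)[OF w] by metis
  then show ?thesis using True by (auto simp: parent_label_def)
next
  case False
  have "parent v \<notin> subtree F v"
    using strict_prefix_parent[OF v] by (auto simp: subtree_def)
  then have "w (parent v) \<notin> w ` subtree F v"
    using inj_on_image_mem_iff[OF labelingsD(1)[OF w] parent_in_verts[OF v False] subtree_subset]
    by simp
  then show ?thesis using False by (simp add: parent_label_def)
qed

lemma gap_eq_card:
  assumes w: "w \<in> labelings F" and v: "v \<in> verts F"
  shows "gap F v w = card {u \<in> subtree F v. cyc_between (w v) (w u) (parent_label F w v)}"
proof -
  have "{x \<in> w ` subtree F v. cyc_between (w v) x (parent_label F w v)} =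
    w ` {u \<in> subtree F v. cyc_between (w v) (w u) (parent_label F w v)}" by auto
  moreover have "inj_on w {u \<in> subtree F v. cyc_between (w v) (w u) (parent_label F w v)}"
    by (rule inj_on_subset[OF labelingsD(1)[OF w]]) (auto simp: subtree_def)
  ultimately show ?thesis by (simp add: gap_def cyc_gap_def card_image)
qed

lemma Cbtmax_iff_gap:
  assumes w: "w \<in> labelings F" and v: "v \<in> verts F"
  shows "v \<in> Cbtmax F w \<longleftrightarrow> gap F v w = 0"
proof -
  let ?p = "parent_label F w v"
  have ne: "w u \<noteq> ?p" if "u \<in> subtree F v" for u
    using parent_label_fresh[OF w v] that by (metis imageI)
  have ne': "w u \<noteq> w v" if "below F u v" for u
    using that v labelingsD(1)[OF w] by (auto simp: below_iff inj_on_def)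
  have below: "below F u v \<longleftrightarrow> u \<in> subtree F v \<and> u \<noteq> v" for u
    using vertex_not_Nil[OF v] by (auto simp: below_iff subtree_def strict_prefix_def)
  have "gap F v w = 0 \<longleftrightarrow> (\<forall>u\<in>subtree F v. \<not> cyc_between (w v) (w u) ?p)"
    using finite_subtree by (auto simp: gap_eq_card[OF w v])
  also have "\<dots> \<longleftrightarrow> (\<forall>u. below F u v \<longrightarrow> \<not> cyc_between (w v) (w u) ?p)"
    by (auto simp: below cyc_between_def)
  also have "\<dots> \<longleftrightarrow> v \<in> Cbtmax F w"
  proof (cases "w v < ?p")
    case True
    have "cyc_between (w v) (w u) ?p \<longleftrightarrow> w u \<in> {w v..?p}" if "below F u v" for u
    proof -
      have "w u \<noteq> ?p" "w u \<noteq> w v" using that below ne ne' by blast+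
      then show ?thesis using True by (auto simp: cyc_between_def)
    qed
    then show ?thesis using True v by (auto simp: Cbtmax_def)
  next
    case False
    then have lt: "?p < w v" using ne[OF self_in_subtree[OF v]] by simp
    have "cyc_between (w v) (w u) ?p \<longleftrightarrow> w u \<notin> {?p..w v}" if "below F u v" for u
    proof -
      have "w u \<noteq> ?p" "w u \<noteq> w v" using that below ne ne' by blast+
      then show ?thesis using lt by (auto simp: cyc_between_def)
    qed
    then show ?thesis using lt v by (auto simp: Cbtmax_def)
  qed
  finally show ?thesis by simp
qed

section \<open>The major index as a sum of gaps\<close>

text \<open>
  If \<open>w v\<close> is smaller than the parent's label, the gap counts the labels above \<open>w v\<close> that are not above
  the parent's label. If it is larger, the gap counts the labels above \<open>w v\<close> and those below the
  parent's label, and the latter number \<open>hook F v\<close> minus those above the parent's label. Subtraction is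
  avoided by moving the negative term to the left.
\<close>

lemma gap_decomposition:
  assumes w: "w \<in> labelings F" and v: "v \<in> verts F"
  shows "gap F v w + card {u \<in> subtree F v. parent_label F w v < w u} =
    card {u \<in> subtree F v. w v < w u} + (if v \<in> Des F w then hook F v else 0)"
proof -
  let ?S = "subtree F v" and ?p = "parent_label F w v"
  let ?G = "{u \<in> ?S. cyc_between (w v) (w u) ?p}" and ?B = "{u \<in> ?S. ?p < w u}"
    and ?A = "{u \<in> ?S. w v < w u}"
  note fin = finite_subtree[of F v]
  have ne: "w u \<noteq> ?p" if "u \<in> ?S" for u
    using parent_label_fresh[OF w v] that by (metis imageI)
  have "w v \<le> card (verts F)" using labelingsD(2)[OF w] v by auto
  then have des: "v \<in> Des F w \<longleftrightarrow> ?p < w v"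
    using v by (auto simp: Des_def parent_label_def)
  show ?thesis
  proof (cases "w v < ?p")
    case True
    have "?A = ?G \<union> ?B" "?G \<inter> ?B = {}" using True ne
      by (auto simp: cyc_between_def) (metis linorder_neqE_nat)
    then have "card ?A = card ?G + card ?B" using fin by (simp add: card_Un_disjoint)
    then show ?thesis using True by (simp add: gap_eq_card[OF w v] des)
  next
    case False
    then have lt: "?p < w v" using ne[OF self_in_subtree[OF v]] by simp
    let ?L = "{u \<in> ?S. w u < ?p}"
    have "?G = ?A \<union> ?L" "?A \<inter> ?L = {}" using lt by (auto simp: cyc_between_def)
    then have 1: "card ?G = card ?A + card ?L" using fin by (simp add: card_Un_disjoint)
    have "?S = ?L \<union> ?B" "?L \<inter> ?B = {}" using ne by (auto simp: nat_neq_iff)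
    then have "card ?S = card ?L + card ?B"
      using fin card_Un_disjoint[of ?L ?B] by simp
    then show ?thesis using lt 1 by (simp add: gap_eq_card[OF w v] des hook_eq_card_subtree[OF v])
  qed
qed

text \<open>
  Both sides count the pairs of a vertex \<open>v\<close> and a proper descendant \<open>u\<close> with a larger label: on the
  right, such a pair is recorded by the child of \<open>v\<close> on the path to \<open>u\<close>. Roots contribute nothing on
  the right, as their parent label \<open>n + 1\<close> exceeds every label.
\<close>

lemma sum_inversions_by_child:
  assumes w: "w \<in> labelings F"
  shows "(\<Sum>v\<in>verts F. card {u \<in> subtree F v. w v < w u}) =
    (\<Sum>v\<in>verts F. card {u \<in> subtree F v. parent_label F w v < w u})"
proof -
  let ?I = "SIGMA v:verts F. {u \<in> subtree F v. w v < w u}"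
  let ?J = "SIGMA v:verts F. {u \<in> subtree F v. parent_label F w v < w u}"
  have J: "\<not> is_root v \<and> w (parent v) < w u" if "(v, u) \<in> ?J" for v u
  proof -
    have "w u \<le> card (verts F)" using that labelingsD(2)[OF w] by (auto simp: subtree_def)
    then show ?thesis using that by (auto simp: parent_label_def split: if_splits)
  qed
  have "bij_betw (\<lambda>(v, u). (parent v, u)) ?J ?I"
  proof (rule bij_betwI)
    show "(\<lambda>(v, u). (parent v, u)) \<in> ?J \<rightarrow> ?I"
    proof (rule Pi_I)
      fix y assume y_in: "y \<in> ?J"
      then obtain v u where y: "y = (v, u)" "v \<in> verts F" "u \<in> subtree F v" by auto
      then have nr: "\<not> is_root v \<and> w (parent v) < w u" using J y_in by blast
      have "prefix (parent v) v" by (simp add: parent_def prefixeq_butlast)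
      then have "u \<in> subtree F (parent v)"
        using y(3) by (auto simp: subtree_def intro: prefix_order.trans)
      then show "(case y of (v, u) \<Rightarrow> (parent v, u)) \<in> ?I"
        using y nr parent_in_verts[of v F] by simp
    qed
    \<comment> \<open>The child of \<open>v\<close> towards \<open>u\<close> is the prefix of \<open>u\<close> that is longer than \<open>v\<close> by one.\<close>
    show "(\<lambda>(v, u). (take (Suc (length v)) u, u)) \<in> ?I \<rightarrow> ?J"
    proof (rule Pi_I)
      fix y assume "y \<in> ?I"
      then obtain v u where y: "y = (v, u)" "v \<in> verts F" "u \<in> subtree F v" "w v < w u" by auto
      then have "strict_prefix v u" by (auto simp: subtree_def strict_prefix_def)
      then obtain x r where u: "u = v @ x # r" by (auto elim: strict_prefixE')
      have "u \<in> verts F" using y(3) by (simp add: subtree_def)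
      then have "v @ [x] \<in> verts F" by (rule verts_prefix) (simp_all add: u)
      then show "(case y of (v, u) \<Rightarrow> (take (Suc (length v)) u, u)) \<in> ?J"
        using y u vertex_not_Nil[OF y(2)]
        by (simp add: subtree_def parent_label_def is_root_def parent_def)
    qed
    fix y assume "y \<in> ?J"
    then obtain v u where y: "y = (v, u)" "v \<in> verts F" "u \<in> subtree F v" by auto
    then obtain r where "u = v @ r" by (auto simp: subtree_def prefix_def)
    then show "(case (case y of (v, u) \<Rightarrow> (parent v, u)) of (v, u) \<Rightarrow> (take (Suc (length v)) u, u)) = y"
      using y vertex_not_Nil[of v F] by (simp add: parent_def)
  next
    fix y assume "y \<in> ?I"
    then obtain v u where y: "y = (v, u)" "v \<in> verts F" "u \<in> subtree F v" "w v < w u" by auto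
    then have "strict_prefix v u" by (auto simp: subtree_def strict_prefix_def)
    then obtain x r where "u = v @ x # r" by (auto elim: strict_prefixE')
    then show "(case (case y of (v, u) \<Rightarrow> (take (Suc (length v)) u, u)) of (v, u) \<Rightarrow> (parent v, u)) = y"
      using y by (simp add: parent_def)
  qed
  then have "card ?J = card ?I" by (rule bij_betw_same_card)
  then show ?thesis using finite_verts finite_subtree by (simp add: card_SigmaI)
qed

lemma maj_eq_sum_gap:
  assumes w: "w \<in> labelings F"
  shows "maj F w = (\<Sum>v\<in>verts F. gap F v w)"
proof -
  have "(\<Sum>v\<in>verts F. gap F v w) + (\<Sum>v\<in>verts F. card {u \<in> subtree F v. parent_label F w v < w u}) =
    (\<Sum>v\<in>verts F. card {u \<in> subtree F v. w v < w u}) +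
    (\<Sum>v\<in>verts F. if v \<in> Des F w then hook F v else 0)"
    unfolding sum.distrib[symmetric] by (intro sum.cong refl gap_decomposition[OF w])
  moreover have "(\<Sum>v\<in>verts F. if v \<in> Des F w then hook F v else 0) = maj F w"
    unfolding maj_def using finite_verts
    by (simp add: sum.If_cases Int_absorb1 Des_def) (rule sum.cong; auto)
  ultimately show ?thesis using sum_inversions_by_child[OF w] by simp
qed

section \<open>Rotating the labels of a subtree\<close>

definition rotate_subtree :: "plane_forest \<Rightarrow> vertex \<Rightarrow> (vertex \<Rightarrow> nat) \<Rightarrow> vertex \<Rightarrow> nat" where
  "rotate_subtree F v w u =
     (if u \<in> subtree F v then cyc_next (w ` subtree F v) (w u) else w u)"

text \<open>
  The rotation permutes the labels of the subtree, so it preserves the label set of every set of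
  vertices that contains the subtree or avoids it.
\<close>

lemma rotate_subtree_image:
  assumes T: "subtree F v \<subseteq> T \<or> T \<inter> subtree F v = {}"
  shows "rotate_subtree F v w ` T = w ` T"
proof -
  have "rotate_subtree F v w ` subtree F v = cyc_next (w ` subtree F v) ` w ` subtree F v"
    by (auto simp: rotate_subtree_def)
  also have "\<dots> = w ` subtree F v"
    using cyc_next_bij[of "w ` subtree F v"] finite_subtree by (simp add: bij_betw_def)
  finally have in_S: "rotate_subtree F v w ` subtree F v = w ` subtree F v" .
  have out: "rotate_subtree F v w ` U = w ` U" if "U \<inter> subtree F v = {}" for U
    using that by (intro image_cong) (auto simp: rotate_subtree_def)
  from T show ?thesis
  proof
    assume "subtree F v \<subseteq> T"
    then have "T = subtree F v \<union> (T - subtree F v)" by auto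
    then show ?thesis using in_S out[of "T - subtree F v"] by (metis image_Un Diff_disjoint Int_commute)
  qed (rule out)
qed

lemma rotate_subtree_in_labelings:
  assumes w: "w \<in> labelings F"
  shows "rotate_subtree F v w \<in> labelings F"
proof (rule labelingsI)
  have im: "rotate_subtree F v w ` verts F = w ` verts F"
    by (rule rotate_subtree_image) (simp add: subtree_subset)
  show "inj_on (rotate_subtree F v w) (verts F)"
    using im card_image[OF labelingsD(1)[OF w]] by (intro eq_card_imp_inj_on finite_verts) simp
  show "rotate_subtree F v w ` verts F = {1..card (verts F)}"
    using im labelingsD(2)[OF w] by simp
  show "rotate_subtree F v w \<in> extensional (verts F)"
    using labelingsD(3)[OF w] subtree_subset[of F v]
    by (auto simp: extensional_def rotate_subtree_def)
qed

text \<open>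
  The label set of the subtree survives the rotation, so the rotated labeling determines which
  permutation of labels has to be undone.
\<close>

lemma rotate_subtree_bij: "bij_betw (rotate_subtree F v) (labelings F) (labelings F)"
proof -
  have "inj_on (rotate_subtree F v) (labelings F)"
  proof (rule inj_onI)
    fix w w' assume eq: "rotate_subtree F v w = rotate_subtree F v w'"
    let ?S = "subtree F v"
    have S: "w ` ?S = w' ` ?S"
      using rotate_subtree_image[of F v ?S w] rotate_subtree_image[of F v ?S w'] eq by simp
    have inj: "inj_on (cyc_next (w ` ?S)) (w ` ?S)"
      using cyc_next_bij[of "w ` ?S"] finite_subtree by (simp add: bij_betw_def)
    show "w = w'"
    proof
      fix u
      show "w u = w' u"
      proof (cases "u \<in> ?S")
        case True
        then have "cyc_next (w ` ?S) (w u) = cyc_next (w ` ?S) (w' u)"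
          using fun_cong[OF eq, of u] S by (simp add: rotate_subtree_def)
        moreover have "w u \<in> w ` ?S" using True by (rule imageI)
        moreover have "w' u \<in> w ` ?S" unfolding S using True by (rule imageI)
        ultimately show ?thesis by (rule inj_onD[OF inj])
      qed (use fun_cong[OF eq, of u] in \<open>simp add: rotate_subtree_def\<close>)
    qed
  qed
  then show ?thesis
    using endo_inj_surj[OF finite_labelings] rotate_subtree_in_labelings
    unfolding bij_betw_def by blast
qed

text \<open>
  The parent's label and the label set of the subtree stay, and the label of \<open>v\<close> moves to its cyclic
  successor.
\<close>

lemma gap_rotate_same:
  assumes w: "w \<in> labelings F" and v: "v \<in> verts F"
  shows "gap F v w = Suc (gap F v (rotate_subtree F v w)) mod hook F v"
proof -
  let ?S = "w ` subtree F v" and ?w = "rotate_subtree F v w"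
  have "parent v \<notin> subtree F v"
    using strict_prefix_parent[OF v] by (auto simp: subtree_def)
  then have "parent_label F ?w v = parent_label F w v"
    by (simp add: parent_label_def rotate_subtree_def)
  moreover have "?w ` subtree F v = ?S" by (rule rotate_subtree_image) simp
  moreover have "?w v = cyc_next ?S (w v)"
    using self_in_subtree[OF v] by (simp add: rotate_subtree_def)
  moreover have "card ?S = hook F v"
    using inj_on_subset[OF labelingsD(1)[OF w] subtree_subset[of F v]]
    by (simp add: card_image hook_eq_card_subtree[OF v])
  ultimately show ?thesis
    using cyc_gap_step[of ?S "w v" "parent_label F w v"] parent_label_fresh[OF w v]
      self_in_subtree[OF v] finite_subtree by (simp add: gap_def)
qed

text \<open>
  If \<open>u\<close> is a proper descendant of \<open>v\<close>, then the parent of \<open>u\<close> is also in the subtree of \<open>v\<close>, so all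
  labels that matter for \<open>u\<close> are moved by the same cyclic-order preserving map. Otherwise neither \<open>u\<close>
  nor its parent is moved, and the subtree of \<open>u\<close> contains that of \<open>v\<close> or is disjoint from it, so its
  label set is preserved.
\<close>

lemma gap_rotate_other:
  assumes u: "u \<in> verts F" and v: "v \<in> verts F" and ne: "u \<noteq> v"
  shows "gap F u (rotate_subtree F v w) = gap F u w"
proof (cases "u \<in> subtree F v")
  case True
  let ?S = "w ` subtree F v" and ?w = "rotate_subtree F v w"
  have "strict_prefix v u" using True ne by (auto simp: subtree_def strict_prefix_def)
  then have pre: "prefix v (parent u)" using prefix_parent_iff[OF u] by simp
  then have nr: "\<not> is_root u"
    using vertex_not_Nil[OF v] is_root_iff_butlast[OF u] by (auto simp: parent_def)
  have par: "parent u \<in> subtree F v"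
    using pre parent_in_verts[OF u nr] by (simp add: subtree_def)
  have sub: "subtree F u \<subseteq> subtree F v"
    using True by (auto simp: subtree_def intro: prefix_order.trans)
  have im: "?w ` subtree F u = cyc_next ?S ` (w ` subtree F u)"
    unfolding image_image using sub by (intro image_cong) (auto simp: rotate_subtree_def)
  have "gap F u ?w = cyc_gap (cyc_next ?S ` (w ` subtree F u)) (cyc_next ?S (w u)) (cyc_next ?S (w (parent u)))"
    unfolding gap_def im using nr True par by (simp add: parent_label_def rotate_subtree_def)
  also have "\<dots> = cyc_gap (w ` subtree F u) (w u) (w (parent u))"
    using True par sub finite_subtree by (intro cyc_gap_cyc_next) auto
  finally show ?thesis using nr by (simp add: gap_def parent_label_def)
next
  case False
  then have npre: "\<not> prefix v u" using u by (simp add: subtree_def)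
  then have "parent u \<notin> subtree F v"
    using prefix_parent_iff[OF u] unfolding subtree_def strict_prefix_def by blast
  moreover have "subtree F v \<subseteq> subtree F u \<or> subtree F u \<inter> subtree F v = {}"
  proof (cases "prefix u v")
    case True
    then have "subtree F v \<subseteq> subtree F u"
      unfolding subtree_def using prefix_order.trans[OF True] by blast
    then show ?thesis ..
  next
    case False
    then have "subtree F u \<inter> subtree F v = {}"
      unfolding subtree_def using npre prefix_same_cases by blast
    then show ?thesis ..
  qed
  ultimately show ?thesis
    using False rotate_subtree_image[of F v "subtree F u" w]
    by (simp add: gap_def parent_label_def rotate_subtree_def)
qed

section \<open>The generating function\<close>

lemma weight_as_product:
  assumes w: "w \<in> labelings F"
  shows "qX ^ maj F w * (\<Prod>v\<in>Cbtmax F w. tX v) =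
    (\<Prod>v\<in>verts F. qX ^ gap F v w * (if gap F v w = 0 then tX v else 1))"
proof -
  have "Cbtmax F w = {v \<in> verts F. gap F v w = 0}"
    using Cbtmax_iff_gap[OF w] by (auto simp: Cbtmax_def)
  then have "(\<Prod>v\<in>Cbtmax F w. tX v) = (\<Prod>v\<in>verts F. if gap F v w = 0 then tX v else 1)"
    by (simp add: prod.inter_filter finite_verts)
  then show ?thesis by (simp add: maj_eq_sum_gap[OF w] power_sum prod.distrib)
qed

lemma sum_gap_weights:
  assumes "h > 0"
  shows "(\<Sum>j<h. qX ^ j * (if j = 0 then tX v else 1)) = q_bracket h - 1 + tX v"
  using assms by (cases h) (simp_all add: q_bracket_def sum.lessThan_Suc_shift del: sum.lessThan_Suc)

lemma Const_mult: "Const a * Const b = Const (a * b)"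
  by (simp add: Const_def mult_single)

lemma Const_of_nat: "Const (of_nat k) = of_nat k"
  by (simp add: Const_def)

text \<open>
  Cancelling \<open>m\<close> is possible because nonzero rational constants are units of the polynomial ring.
\<close>

lemma eq_Const_quotient_mult:
  fixes a m :: nat
  assumes "of_nat m * S = of_nat a * P" "m \<noteq> 0"
  shows "S = Const (of_nat a / of_nat m) * P"
proof -
  have "S = Const (1 / of_nat m) * (of_nat m * S)"
    using assms(2) by (simp add: Const_mult mult.assoc[symmetric] Const_of_nat[symmetric])
      (simp add: Const_def)
  also have "\<dots> = Const (1 / of_nat m) * Const (of_nat a) * P"
    by (simp add: assms(1) Const_of_nat mult.assoc)
  finally show ?thesis by (simp add: Const_mult)
qed

theorem theorem4p4:
  fixes F :: plane_forest and n :: nat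
  assumes "card (verts F) = n" and "n \<ge> 1"
  shows "(\<Sum>w\<in>labelings F. qX ^ maj F w * (\<Prod>v\<in>Cbtmax F w. tX v)) =
         Const (fact n / (\<Prod>v\<in>verts F. of_nat (hook F v))) *
         (\<Prod>v\<in>verts F. q_bracket (hook F v) - 1 + tX v)"
proof -
  let ?f = "\<lambda>v j. qX ^ j * (if j = 0 then tX v else 1)"
  let ?S = "\<Sum>w\<in>labelings F. \<Prod>v\<in>verts F. ?f v (gap F v w)"
  have "of_nat (\<Prod>v\<in>verts F. hook F v) * ?S =
    of_nat (card (labelings F)) * (\<Prod>v\<in>verts F. \<Sum>j<hook F v. ?f v j)"
  proof (rule independent_uniform[where h = "hook F" and \<rho> = "rotate_subtree F" and c = "gap F"
        and f = ?f])
    show "gap F v w = Suc (gap F v (rotate_subtree F v w)) mod hook F v"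
      if "v \<in> verts F" "w \<in> labelings F" for v w
      using that(2,1) by (rule gap_rotate_same)
  qed (rule finite_labelings finite_verts hook_pos rotate_subtree_bij gap_rotate_other; assumption)+
  also have "\<dots> = of_nat (fact n) * (\<Prod>v\<in>verts F. q_bracket (hook F v) - 1 + tX v)"
    using assms(1) by (simp add: card_labelings sum_gap_weights hook_pos cong: prod.cong)
  finally have "?S = Const (of_nat (fact n) / of_nat (\<Prod>v\<in>verts F. hook F v)) *
      (\<Prod>v\<in>verts F. q_bracket (hook F v) - 1 + tX v)"
    by (rule eq_Const_quotient_mult) (use hook_pos[of _ F] finite_verts in auto)
  then show ?thesis by (simp add: weight_as_product cong: sum.cong)
qed

end
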